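(* Let $n_i\ge 1$ be an integer, let $\varphi'_{i,1}\ge\varphi'_{i,2}\ge\cdots\ge\varphi'_{i,n_i}$ be real numbers, and let $q_i^{k+1},y_{1,i}^k\in\mathbb{R}$ and $\rho>0$. For each $c\in\{1,\dots,n_i\}$ put $$a_{i,c}=\frac{\sum_{j=1}^{c}\varphi'_{i,j}+q_i^{k+1}+y_{1,i}^k/\rho}{c+1},$$ and let $h(t_i)|_{t_{i,j^*}=a_{i,c}}$ denote the value of $$h(t_i)=\bigl(q_i^{k+1}-t_{i,j^*}+y_{1,i}^k/\rho\bigr)^2+\sum_{j=1}^{n_i}\bigl(t_{i,j}-\varphi'_{i,j}\bigr)^2$$ at $t_{i,j^*}=a_{i,c}$, $t_{i,j}=a_{i,c}$ for $1\le j\le c$, and $t_{i,j}=\varphi'_{i,j}$ for $c<j\le n_i$. Then $h(t_i)|_{t_{i,j^*}=a_{i,c}}$ increases monotonically (in the weak sense) with $c$, i.e. for all $c\in\{1,\dots,n_i-1\}$, $$h(t_i)|_{t_{i,j^*}=a_{i,c}}\le h(t_i)|_{t_{i,j^*}=a_{i,c+1}} .$$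
   Context: The index $i$ is fixed and the superscripts $k$, $k+1$ are iteration indices only; $q_i^{k+1},y_{1,i}^k,\rho$ and the $\varphi'_{i,j}$ are given constants. The numbers $\varphi'_{i,1},\dots,\varphi'_{i,n_i}$ are the entries of a given vector $\varphi_i\in\mathbb{R}^{n_i}$ rearranged in decreasing order, and the coordinates of $t_i=(t_{i,1},\dots,t_{i,n_i})$ are indexed in this order. The function $h$ comes from the problem of minimizing $(q_i^{k+1}-t_{i,j^*}+y_{1,i}^k/\rho)^2+\Vert t_i-\varphi_i\Vert_2^2$ with $t_{i,j^*}=\max_j t_{i,j}$. The integer $c$ is the size of the set $C=\{j: t_{i,j}=t_{i,j^*}\}$, which is taken to consist of the indices of the $c$ largest entries of $\varphi_i$; coordinates outside $C$ are set equal to the corresponding entries of $\varphi_i$. *)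

theory Defs
  imports Complex_Main
begin

text \<open>
  Vectors in \<open>\<real>\<^sup>n\<close> are functions \<^typ>\<open>nat \<Rightarrow> real\<close> whose values at the indices
  \<open>1, \<dots>, n\<close> are the entries; other values are never used.  The constants
  \<open>q\<close>, \<open>y\<close> stand for \<open>q_i^{k+1}\<close>, \<open>y_{1,i}^k\<close>, and \<open>\<phi>\<close> for \<open>\<phi>'_{i,1}, \<dots>, \<phi>'_{i,n}\<close>.
\<close>

definition a_val :: "real \<Rightarrow> real \<Rightarrow> real \<Rightarrow> (nat \<Rightarrow> real) \<Rightarrow> nat \<Rightarrow> real" where
  "a_val q y \<rho> \<phi> c = ((\<Sum>j=1..c. \<phi> j) + q + y / \<rho>) / (real c + 1)"

text \<open>
  The value \<open>s\<close> of the distinguished coordinate \<open>t_{i,j*}\<close> is a separate argument of \<open>h\<close>,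
  not \<open>Max (t ` {1..n})\<close>: the substituted value \<open>a_{i,c}\<close> may be smaller than
  \<open>\<phi>'_{i,c+1}\<close>, hence need not be the maximum of the substituted vector.
\<close>

definition h :: "nat \<Rightarrow> real \<Rightarrow> real \<Rightarrow> real \<Rightarrow> (nat \<Rightarrow> real) \<Rightarrow> real \<Rightarrow> (nat \<Rightarrow> real) \<Rightarrow> real" where
  "h n q y \<rho> \<phi> s t = (q - s + y / \<rho>)\<^sup>2 + (\<Sum>j=1..n. (t j - \<phi> j)\<^sup>2)"

definition t_vec :: "real \<Rightarrow> real \<Rightarrow> real \<Rightarrow> (nat \<Rightarrow> real) \<Rightarrow> nat \<Rightarrow> nat \<Rightarrow> real" where
  "t_vec q y \<rho> \<phi> c j = (if j \<le> c then a_val q y \<rho> \<phi> c else \<phi> j)"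

definition h_at :: "nat \<Rightarrow> real \<Rightarrow> real \<Rightarrow> real \<Rightarrow> (nat \<Rightarrow> real) \<Rightarrow> nat \<Rightarrow> real" where
  "h_at n q y \<rho> \<phi> c = h n q y \<rho> \<phi> (a_val q y \<rho> \<phi> c) (t_vec q y \<rho> \<phi> c)"

end

theory Submission
  imports Defs
begin

text \<open>
  On the first \<open>c\<close> coordinates \<open>h\<close> is a sum of squared distances from a common value \<open>s\<close> to
  \<open>c + 1\<close> numbers whose mean is \<open>a\<^sub>c\<close>, so \<open>s = a\<^sub>c\<close> minimises it. Hence replacing \<open>a\<^sub>c\<close> by
  \<open>a\<^bsub>c+1\<^esub>\<close> does not decrease it, and neither does adding the square for coordinate \<open>c + 1\<close>.
\<close>

text \<open>\<open>s\<close> is a free argument because the cost with \<open>c\<close> terms is also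
  evaluated at the next mean, that of index \<open>c + 1\<close>.\<close>

definition cost :: "real \<Rightarrow> (nat \<Rightarrow> real) \<Rightarrow> nat \<Rightarrow> real \<Rightarrow> real" where
  "cost p \<phi> c s = (p - s)\<^sup>2 + (\<Sum>j=1..c. (s - \<phi> j)\<^sup>2)"

lemma cost_eq:
  "cost p \<phi> c s = (real c + 1) * s\<^sup>2 - 2 * ((\<Sum>j=1..c. \<phi> j) + p) * s + (p\<^sup>2 + (\<Sum>j=1..c. (\<phi> j)\<^sup>2))"
  by (induction c) (simp_all add: cost_def power2_eq_square algebra_simps)

lemma cost_a_val_le: "cost (q + y / \<rho>) \<phi> c (a_val q y \<rho> \<phi> c) \<le> cost (q + y / \<rho>) \<phi> c s"
proof -
  let ?a = "a_val q y \<rho> \<phi> c"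
  \<comment> \<open>This makes \<open>?a\<close> the vertex of the quadratic in
    \<open>cost_eq\<close>; substituting it into the linear coefficient completes the
    square.\<close>
  have "(\<Sum>j=1..c. \<phi> j) + (q + y / \<rho>) = (real c + 1) * ?a"
    by (simp add: a_val_def add.assoc)
  then have "cost (q + y / \<rho>) \<phi> c s - cost (q + y / \<rho>) \<phi> c ?a = (real c + 1) * (s - ?a)\<^sup>2"
    by (simp only: cost_eq) (simp add: power2_eq_square algebra_simps)
  moreover have "0 \<le> (real c + 1) * (s - ?a)\<^sup>2"
    by simp
  ultimately show ?thesis
    by linarith
qed

text \<open>Coordinates beyond \<open>c\<close> contribute zero, since \<open>t_vec\<close> agrees
  with \<open>\<phi>\<close> there; \<open>c \<le> n\<close> keeps the first \<open>c\<close> terms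
  inside the sum.\<close>

lemma h_at_eq_cost:
  assumes "c \<le> n"
  shows "h_at n q y \<rho> \<phi> c = cost (q + y / \<rho>) \<phi> c (a_val q y \<rho> \<phi> c)"
proof -
  have "(\<Sum>j=1..n. (t_vec q y \<rho> \<phi> c j - \<phi> j)\<^sup>2) = (\<Sum>j=1..c. (a_val q y \<rho> \<phi> c - \<phi> j)\<^sup>2)"
    using assms by (intro sum.mono_neutral_cong_right) (auto simp: t_vec_def)
  then show ?thesis
    by (simp add: h_at_def h_def cost_def algebra_simps)
qed

theorem theorem2:
  fixes n :: nat and \<phi> :: "nat \<Rightarrow> real" and q y \<rho> :: real
  assumes "n \<ge> 1"
    and "antimono_on {1..n} \<phi>"
    and "\<rho> > 0"
  shows "\<forall>c\<in>{1..n - 1}. h_at n q y \<rho> \<phi> c \<le> h_at n q y \<rho> \<phi> (c + 1)"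
proof
  fix c assume "c \<in> {1..n - 1}"
  then have "c \<le> n" "c + 1 \<le> n"
    using assms(1) by auto
  let ?cost = "cost (q + y / \<rho>) \<phi>" and ?a = "a_val q y \<rho> \<phi>"
  have "?cost c (?a c) \<le> ?cost c (?a (c + 1))"
    by (rule cost_a_val_le)
  also have "\<dots> \<le> ?cost (c + 1) (?a (c + 1))"
    by (simp add: cost_def)
  finally show "h_at n q y \<rho> \<phi> c \<le> h_at n q y \<rho> \<phi> (c + 1)"
    using \<open>c \<le> n\<close> \<open>c + 1 \<le> n\<close> by (simp only: h_at_eq_cost)
qed

end
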